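(* For every projective link diagram $K$, one has $\langle K\rangle=\langle\pi(K)\rangle$, where the first bracket is the bracket polynomial defined directly on the projective diagram and the second is the usual bracket polynomial of the virtual link diagram $\pi(K)$.
   Context: Projective diagrams. $\mathbb{R}P^2$ is represented as a closed disk with antipodal boundary points identified. A link in $\mathbb{R}P^3$ is represented by a projective link diagram: a tangle diagram in the disk (generic immersed arcs and circles with over/under information at each double point) whose endpoints lie on the boundary circle and form antipodal pairs. The map $\pi$. Given a projective link diagram $K$, regard the disk as embedded in the plane (or 2-sphere). For each antipodal pair of endpoints on the boundary circle draw an arc in the complement of the disk joining them; these arcs may cross each other transversally, and every such crossing is declared a virtual crossing. The resulting virtual link diagram is $\pi(K)$. Brackets. Both brackets take values in $\mathbb{Z}[A,A^{-1}]$ and are defined by the same state sum: every classical crossing is smoothed in both ways, with coefficient $A$ for an $A$-smoothing and $A^{-1}$ for a $B$-smoothing, and a state with $n$ closed loops is evaluated as $(-A^2-A^{-2})^{n}$. (The $A$-smoothing joins the two regions swept out when the overstrand is turned counterclockwise towards the understrand.) For the projective bracket (Drobotukhina), smoothings are made in the disk and the loops are the closed curves in $\mathbb{R}P^2$ obtained after identifying antipodal endpoints on the boundary, each loop, null-homotopic or not, contributing one factor $-A^2-A^{-2}$. For the virtual bracket, smoothings are made in the planar virtual diagram, virtual crossings are left as they are, and the loops are the resulting closed curves, possibly with virtual crossings. *)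

theory Defs
  imports "HOL-Analysis.Analysis" "HOL-Library.Poly_Mapping"
begin

section \<open>The coefficient ring\<close>

text \<open>The ring of Laurent polynomials in one variable \<open>A\<close> over the integers is the monoid
  algebra of the additive group of exponents, that is, finitely supported functions from
  exponents to coefficients with the convolution product.\<close>

type_synonym laurent = "int \<Rightarrow>\<^sub>0 int"

definition varA :: laurent where "varA = Poly_Mapping.single 1 1"

definition varA_inv :: laurent where "varA_inv = Poly_Mapping.single (- 1) 1"

lemma varA_mult_inv: "varA * varA_inv = 1"
  by (simp add: varA_def varA_inv_def Poly_Mapping.mult_single)

section \<open>Generic systems of curves in the plane\<close>

text \<open>A system of curves is a list of paths defined on the unit interval (values of a path
  outside the unit interval play no role, apart from the derivatives at 0 and 1 being taken
  two-sidedly). Points of its parameter space are pairs (index of the path, time). A closed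
  curve is a chain of one or more paths glued end to end; in particular an immersed circle is a
  single path whose two ends coincide.\<close>

type_synonym param = "nat \<times> real"
type_synonym curve_system = "(real \<Rightarrow> complex) list"

definition params :: "curve_system \<Rightarrow> param set" where
  "params cs = {(i, t). i < length cs \<and> t \<in> {0..1}}"

definition end_params :: "curve_system \<Rightarrow> param set" where
  "end_params cs = {(i, t). i < length cs \<and> t \<in> {0, 1}}"

definition inner_params :: "curve_system \<Rightarrow> param set" where
  "inner_params cs = {(i, t). i < length cs \<and> t \<in> {0<..<1}}"

definition pt :: "curve_system \<Rightarrow> param \<Rightarrow> complex" where
  "pt cs p = (cs ! fst p) (snd p)"

definition tangent :: "curve_system \<Rightarrow> param \<Rightarrow> complex" where
  "tangent cs p = vector_derivative (cs ! fst p) (at (snd p))"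

definition det2 :: "complex \<Rightarrow> complex \<Rightarrow> real" where
  "det2 u v = Re u * Im v - Im u * Re v"

definition immersed :: "(real \<Rightarrow> complex) \<Rightarrow> bool" where
  "immersed c \<longleftrightarrow> c C1_differentiable_on {0..1} \<and>
     (\<forall>t\<in>{0..1}. vector_derivative c (at t) \<noteq> 0)"

text \<open>A double point is recorded as the unordered pair of its two parameters. Ends of paths,
  including the base point of a circle, are kept away from the double points by genericity.\<close>

definition double_points :: "curve_system \<Rightarrow> param set set" where
  "double_points cs =
     {{p, q} | p q. p \<in> inner_params cs \<and> q \<in> inner_params cs \<and> p \<noteq> q \<and> pt cs p = pt cs q}"

definition generic :: "curve_system \<Rightarrow> bool" where
  "generic cs \<longleftrightarrow>
     (\<forall>c\<in>set cs. immersed c) \<and>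
     finite (double_points cs) \<and>
     (\<forall>p\<in>inner_params cs. \<forall>q\<in>end_params cs. pt cs p \<noteq> pt cs q) \<and>
     (\<forall>p\<in>inner_params cs. \<forall>q\<in>inner_params cs. p \<noteq> q \<longrightarrow> pt cs p = pt cs q \<longrightarrow>
        det2 (tangent cs p) (tangent cs q) \<noteq> 0) \<and>
     (\<forall>p\<in>inner_params cs. \<forall>q\<in>inner_params cs. \<forall>r\<in>inner_params cs.
        pt cs p = pt cs q \<longrightarrow> pt cs q = pt cs r \<longrightarrow> p = q \<or> q = r \<or> p = r)"

section \<open>Projective and virtual link diagrams\<close>

text \<open>A classical crossing is the pair (parameter on the overstrand, parameter on the
  understrand); a virtual crossing is a double point without such information.\<close>

record diagram =
  strands :: curve_system
  crossings :: "(param \<times> param) set"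

record virtual_diagram = diagram +
  virtuals :: "param set set"

definition unordered :: "'a \<times> 'a \<Rightarrow> 'a set" where
  "unordered x = {fst x, snd x}"

definition proper_arc :: "(real \<Rightarrow> complex) \<Rightarrow> bool" where
  "proper_arc c \<longleftrightarrow> norm (c 0) = 1 \<and> norm (c 1) = 1 \<and> (\<forall>t\<in>{0<..<1}. norm (c t) < 1)"

definition inner_circle :: "(real \<Rightarrow> complex) \<Rightarrow> bool" where
  "inner_circle c \<longleftrightarrow> c 0 = c 1 \<and> vector_derivative c (at 0) = vector_derivative c (at 1) \<and>
     (\<forall>t\<in>{0..1}. norm (c t) < 1)"

definition boundary_points :: "curve_system \<Rightarrow> complex set" where
  "boundary_points cs = {z. norm z = 1 \<and> (\<exists>p\<in>end_params cs. z = pt cs p)}"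

text \<open>The projective plane is the closed unit disk in the complex plane with \<open>z\<close> and \<open>- z\<close>
  identified when \<open>z\<close> has norm 1.\<close>

definition projective_link_diagram :: "diagram \<Rightarrow> bool" where
  "projective_link_diagram K \<longleftrightarrow>
     generic (strands K) \<and>
     (\<forall>c\<in>set (strands K). proper_arc c \<or> inner_circle c) \<and>
     (\<forall>p\<in>end_params (strands K). \<forall>q\<in>end_params (strands K). pt (strands K) p = pt (strands K) q \<longrightarrow>
        p = q \<or> fst p = fst q \<and> inner_circle (strands K ! fst p)) \<and>
     (\<forall>z\<in>boundary_points (strands K). - z \<in> boundary_points (strands K)) \<and>
     unordered ` crossings K = double_points (strands K) \<and>
     (\<forall>p q. (p, q) \<in> crossings K \<longrightarrow> (q, p) \<notin> crossings K)"

text \<open>The closed curves of a virtual link diagram are the chains of paths formed by gluing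
  coinciding ends; they are allowed to have corners at the gluing points.\<close>

definition virtual_link_diagram :: "virtual_diagram \<Rightarrow> bool" where
  "virtual_link_diagram V \<longleftrightarrow>
     generic (strands V) \<and>
     (\<forall>p\<in>end_params (strands V). \<exists>!q. q \<in> end_params (strands V) \<and> q \<noteq> p \<and>
        pt (strands V) q = pt (strands V) p) \<and>
     unordered ` crossings V \<union> virtuals V = double_points (strands V) \<and>
     unordered ` crossings V \<inter> virtuals V = {} \<and>
     (\<forall>p q. (p, q) \<in> crossings V \<longrightarrow> (q, p) \<notin> crossings V)"

section \<open>The map from projective to virtual diagrams\<close>

text \<open>\<open>closing_arcs K os\<close> says that \<open>os\<close> is an admissible choice of exterior arcs, one for each
  antipodal pair of end points. Genericity of the whole system makes the arcs cross each other
  transversally, in double points only.\<close>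

definition closing_arcs :: "diagram \<Rightarrow> curve_system \<Rightarrow> bool" where
  "closing_arcs K os \<longleftrightarrow>
     (\<forall>c\<in>set os. c 0 \<in> boundary_points (strands K) \<and> c 1 = - c 0 \<and>
        (\<forall>t\<in>{0<..<1}. norm (c t) > 1)) \<and>
     (\<forall>z\<in>boundary_points (strands K). \<exists>!j. j < length os \<and> z \<in> {(os ! j) 0, (os ! j) 1}) \<and>
     generic (strands K @ os)"

definition pi_diagram :: "diagram \<Rightarrow> curve_system \<Rightarrow> virtual_diagram" where
  "pi_diagram K os =
     \<lparr>strands = strands K @ os,
      crossings = crossings K,
      virtuals = {d \<in> double_points (strands K @ os). \<forall>(i, t)\<in>d. length (strands K) \<le> i}\<rparr>"

text \<open>The diagram \<open>pi_diagram K os\<close> is a virtual link diagram, for every admissible choice of exterior arcs.\<close>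

lemma pt_append:
  "fst p < length cs \<Longrightarrow> pt (cs @ os) p = pt cs p"
  "\<not> fst p < length cs \<Longrightarrow> pt (cs @ os) p = pt os (fst p - length cs, snd p)"
  by (simp_all add: pt_def nth_append)

lemma end_params_append:
  "p \<in> end_params (cs @ os) \<longleftrightarrow>
     (if fst p < length cs then p \<in> end_params cs
      else (fst p - length cs, snd p) \<in> end_params os)"
  by (cases p) (auto simp: end_params_def)

lemma inner_params_append:
  "p \<in> inner_params (cs @ os) \<longleftrightarrow>
     (if fst p < length cs then p \<in> inner_params cs
      else (fst p - length cs, snd p) \<in> inner_params os)"
  by (cases p) (auto simp: inner_params_def)

lemma projective_link_diagramD:
  assumes "projective_link_diagram K"
  shows "c \<in> set (strands K) \<Longrightarrow> proper_arc c \<or> inner_circle c"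
    and "p \<in> end_params (strands K) \<Longrightarrow> q \<in> end_params (strands K) \<Longrightarrow>
      pt (strands K) p = pt (strands K) q \<Longrightarrow>
      p = q \<or> fst p = fst q \<and> inner_circle (strands K ! fst p)"
    and "z \<in> boundary_points (strands K) \<Longrightarrow> - z \<in> boundary_points (strands K)"
    and "unordered ` crossings K = double_points (strands K)"
    and "(a, b) \<in> crossings K \<Longrightarrow> (b, a) \<notin> crossings K"
proof -
  note D = assms[unfolded projective_link_diagram_def]
  note D2 = D[THEN conjunct2] and D3 = D[THEN conjunct2, THEN conjunct2]
  note D4 = D3[THEN conjunct2] and D5 = D3[THEN conjunct2, THEN conjunct2]
  note D6 = D5[THEN conjunct2]
  show "c \<in> set (strands K) \<Longrightarrow> proper_arc c \<or> inner_circle c"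
    by (rule D2[THEN conjunct1, rule_format])
  show "p \<in> end_params (strands K) \<Longrightarrow> q \<in> end_params (strands K) \<Longrightarrow>
      pt (strands K) p = pt (strands K) q \<Longrightarrow>
      p = q \<or> fst p = fst q \<and> inner_circle (strands K ! fst p)"
    by (rule D3[THEN conjunct1, rule_format])
  show "z \<in> boundary_points (strands K) \<Longrightarrow> - z \<in> boundary_points (strands K)"
    by (rule D4[THEN conjunct1, rule_format])
  show "unordered ` crossings K = double_points (strands K)"
    by (rule D5[THEN conjunct1])
  show "(a, b) \<in> crossings K \<Longrightarrow> (b, a) \<notin> crossings K"
    by (rule D6[rule_format])
qed

lemma norm_pt_inner:
  assumes "projective_link_diagram K" "p \<in> inner_params (strands K)"
  shows "norm (pt (strands K) p) < 1"
proof -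
  have "strands K ! fst p \<in> set (strands K)" and "snd p \<in> {0<..<1}"
    using assms(2) by (auto simp: inner_params_def)
  moreover from this(1) have "proper_arc (strands K ! fst p) \<or> inner_circle (strands K ! fst p)"
    by (rule projective_link_diagramD(1)[OF assms(1)])
  ultimately show ?thesis
    by (auto simp: pt_def proper_arc_def inner_circle_def)
qed

lemma norm_pt_outer:
  assumes "closing_arcs K os" "p \<in> inner_params os"
  shows "norm (pt os p) > 1"
proof -
  have "os ! fst p \<in> set os" "snd p \<in> {0<..<1}"
    using assms(2) by (auto simp: inner_params_def)
  with assms(1) show ?thesis
    unfolding closing_arcs_def pt_def by blast
qed

lemma norm_boundary: "z \<in> boundary_points cs \<Longrightarrow> norm z = 1"
  by (simp add: boundary_points_def)

lemma pt_end_outer: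
  assumes "projective_link_diagram K" "closing_arcs K os" "p \<in> end_params os"
  shows "pt os p \<in> boundary_points (strands K)"
proof -
  have "os ! fst p \<in> set os" and t: "snd p \<in> {0, 1}"
    using assms(3) by (auto simp: end_params_def)
  with assms(2) have c: "(os ! fst p) 0 \<in> boundary_points (strands K)"
      "(os ! fst p) 1 = - (os ! fst p) 0"
    unfolding closing_arcs_def by blast+
  moreover have "- (os ! fst p) 0 \<in> boundary_points (strands K)"
    by (rule projective_link_diagramD(3)[OF assms(1) c(1)])
  ultimately show ?thesis
    using t by (auto simp: pt_def)
qed

lemma outer_ends_unique:
  assumes K: "projective_link_diagram K" and os: "closing_arcs K os"
    and p: "p \<in> end_params os" and q: "q \<in> end_params os" and eq: "pt os p = pt os q"
  shows "p = q"
proof -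
  have b: "pt os p \<in> boundary_points (strands K)"
    by (rule pt_end_outer[OF K os p])
  have "fst p < length os \<and> pt os p \<in> {(os ! fst p) 0, (os ! fst p) 1}"
    "fst q < length os \<and> pt os p \<in> {(os ! fst q) 0, (os ! fst q) 1}"
    using p q eq by (auto simp: end_params_def pt_def)
  with b os have i: "fst p = fst q"
    unfolding closing_arcs_def by blast
  have c: "os ! fst p \<in> set os"
    using p by (auto simp: end_params_def)
  then have b0: "(os ! fst p) 0 \<in> boundary_points (strands K)"
    and b1: "(os ! fst p) 1 = - (os ! fst p) 0"
    using os unfolding closing_arcs_def by blast+
  from norm_boundary[OF b0] have "(os ! fst p) 0 \<noteq> 0" by auto
  with b1 have "(os ! fst p) 0 \<noteq> (os ! fst p) 1" by simp
  with i p q eq have "snd p = snd q"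
    by (auto simp: end_params_def pt_def)
  with i show ?thesis
    by (simp add: prod_eq_iff)
qed

lemma virtual_link_diagram_pi:
  assumes K: "projective_link_diagram K" and os: "closing_arcs K os"
  shows "virtual_link_diagram (pi_diagram K os)"
proof -
  let ?cs = "strands K" and ?n = "length (strands K)"
  let ?V = "strands K @ os"
  have inj: "p = q \<or> fst p = fst q \<and> inner_circle (?cs ! fst p)"
    if "p \<in> end_params ?cs" "q \<in> end_params ?cs" "pt ?cs p = pt ?cs q" for p q
    by (rule projective_link_diagramD(2)[OF K that])
  have comp: "proper_arc (?cs ! fst p) \<or> inner_circle (?cs ! fst p)" if "p \<in> end_params ?cs" for p
  proof -
    have "?cs ! fst p \<in> set ?cs"
      using that by (auto simp: end_params_def)
    then show ?thesis
      by (rule projective_link_diagramD(1)[OF K])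
  qed
  have circ: "norm (pt ?cs p) < 1" if "p \<in> end_params ?cs" "inner_circle (?cs ! fst p)" for p
    using that by (auto simp: inner_circle_def end_params_def pt_def)
  have arc: "norm (pt ?cs p) = 1" if "p \<in> end_params ?cs" "proper_arc (?cs ! fst p)" for p
    using that by (auto simp: proper_arc_def end_params_def pt_def)
  have ends: "\<exists>!q. q \<in> end_params ?V \<and> q \<noteq> p \<and> pt ?V q = pt ?V p" if p: "p \<in> end_params ?V" for p
  proof (cases "fst p < ?n")
    case True
    then have pK: "p \<in> end_params ?cs" and ptp: "pt ?V p = pt ?cs p"
      using p by (simp_all add: end_params_append pt_append)
    show ?thesis
    proof (cases "inner_circle (?cs ! fst p)")
      case c: True
      have lt: "norm (pt ?cs p) < 1"
        by (rule circ[OF pK c])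
      let ?q = "(fst p, 1 - snd p)"
      have "?q \<in> end_params ?V \<and> ?q \<noteq> p \<and> pt ?V ?q = pt ?V p"
        using pK c True
        by (auto simp: nth_append end_params_def pt_def inner_circle_def)
      moreover have "q = ?q" if q: "q \<in> end_params ?V \<and> q \<noteq> p \<and> pt ?V q = pt ?V p" for q
      proof (cases "fst q < ?n")
        case True
        then have "q \<in> end_params ?cs" "pt ?cs q = pt ?cs p"
          using q ptp by (simp_all add: end_params_append pt_append)
        with inj[of p q] pK q have "fst p = fst q" by auto
        with q \<open>q \<in> end_params ?cs\<close> pK show ?thesis
          by (auto simp: end_params_def prod_eq_iff)
      next
        case False
        then have qo: "(fst q - ?n, snd q) \<in> end_params os"
          and "pt os (fst q - ?n, snd q) = pt ?cs p"
          using q ptp by (simp_all add: end_params_append pt_append)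
        with norm_boundary[OF pt_end_outer[OF K os qo]] lt show ?thesis by simp
      qed
      ultimately show ?thesis by blast
    next
      case c: False
      then have n1: "norm (pt ?cs p) = 1" using comp arc pK by blast
      then have "pt ?cs p \<in> boundary_points ?cs"
        using pK by (auto simp: boundary_points_def)
      then obtain j where j: "j < length os" "pt ?cs p \<in> {(os ! j) 0, (os ! j) 1}"
        using os unfolding closing_arcs_def by blast
      then obtain t where t: "t \<in> {0, 1}" "pt ?cs p = (os ! j) t" by blast
      let ?q = "(?n + j, t)"
      have q0: "?q \<in> end_params ?V \<and> ?q \<noteq> p \<and> pt ?V ?q = pt ?V p"
        using True j t ptp by (auto simp: nth_append end_params_def pt_def)
      moreover have "q = ?q" if q: "q \<in> end_params ?V \<and> q \<noteq> p \<and> pt ?V q = pt ?V p" for q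
      proof (cases "fst q < ?n")
        case True
        then have "q \<in> end_params ?cs" "pt ?cs q = pt ?cs p"
          using q ptp by (simp_all add: end_params_append pt_append)
        with inj[of p q] pK q c show ?thesis by auto
      next
        case False
        then have 1: "(fst q - ?n, snd q) \<in> end_params os"
            "pt os (fst q - ?n, snd q) = pt ?cs p"
          using q ptp by (simp_all add: end_params_append pt_append)
        have 2: "(j, t) \<in> end_params os" "pt os (j, t) = pt ?cs p"
          using j t by (auto simp: end_params_def pt_def)
        from outer_ends_unique[OF K os 1(1) 2(1)] 1(2) 2(2) False show ?thesis
          by (auto simp: prod_eq_iff)
      qed
      ultimately show ?thesis by blast
    qed
  next
    case False
    then have po: "(fst p - ?n, snd p) \<in> end_params os"
      and ptp: "pt ?V p = pt os (fst p - ?n, snd p)"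
      using p by (simp_all add: end_params_append pt_append)
    have "pt ?V p \<in> boundary_points ?cs"
      using pt_end_outer[OF K os po] ptp by simp
    then obtain r where r: "r \<in> end_params ?cs" "pt ?V p = pt ?cs r" "norm (pt ?cs r) = 1"
      by (auto simp: boundary_points_def)
    have rn: "fst r < ?n" using r by (auto simp: end_params_def)
    have "r \<in> end_params ?V \<and> r \<noteq> p \<and> pt ?V r = pt ?V p"
      using r rn False by (auto simp: end_params_append pt_append)
    moreover have "q = r" if q: "q \<in> end_params ?V \<and> q \<noteq> p \<and> pt ?V q = pt ?V p" for q
    proof (cases "fst q < ?n")
      case True
      then have "q \<in> end_params ?cs" "pt ?cs q = pt ?cs r"
        using q r by (simp_all add: end_params_append pt_append)
      with inj[of r q] r circ[of r] show ?thesis by auto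
    next
      case nq: False
      then have "(fst q - ?n, snd q) \<in> end_params os"
          "pt os (fst q - ?n, snd q) = pt os (fst p - ?n, snd p)"
        using q ptp by (simp_all add: end_params_append pt_append)
      from outer_ends_unique[OF K os this(1) po this(2)] nq False q show ?thesis
        by (auto simp: prod_eq_iff)
    qed
    ultimately show ?thesis by blast
  qed
  let ?W = "{d \<in> double_points ?V. \<forall>(i, t)\<in>d. ?n \<le> i}"
  have sub: "double_points ?cs \<subseteq> double_points ?V"
  proof
    fix d assume "d \<in> double_points ?cs"
    then obtain p q where d: "d = {p, q}" "p \<in> inner_params ?cs" "q \<in> inner_params ?cs" "p \<noteq> q"
        "pt ?cs p = pt ?cs q"
      by (auto simp: double_points_def)
    then have "fst p < ?n" "fst q < ?n" by (auto simp: inner_params_def)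
    with d show "d \<in> double_points ?V"
      unfolding double_points_def
      by (intro CollectI exI[of _ p] exI[of _ q]) (simp add: inner_params_append pt_append)
  qed
  have disj: "double_points ?cs \<inter> ?W = {}"
    by (auto simp: double_points_def inner_params_def)
  have cover: "d \<in> double_points ?cs \<union> ?W" if dV: "d \<in> double_points ?V" for d
  proof -
    from dV obtain p q where d: "d = {p, q}" "p \<in> inner_params ?V" "q \<in> inner_params ?V" "p \<noteq> q"
        "pt ?V p = pt ?V q"
      by (auto simp: double_points_def)
    have less: "norm (pt ?V x) < 1" if "x \<in> inner_params ?V" "fst x < ?n" for x
      using that norm_pt_inner[OF K] by (simp add: inner_params_append pt_append)
    have gt: "norm (pt ?V x) > 1" if "x \<in> inner_params ?V" "\<not> fst x < ?n" for x
      using that norm_pt_outer[OF os] by (simp add: inner_params_append pt_append)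
    consider "fst p < ?n" "fst q < ?n" | "\<not> fst p < ?n" "\<not> fst q < ?n"
      using less[of p] less[of q] gt[of p] gt[of q] d by fastforce
    then show ?thesis
    proof cases
      case 1
      with d have "p \<in> inner_params ?cs" "q \<in> inner_params ?cs" "pt ?cs p = pt ?cs q"
        by (simp_all add: inner_params_append pt_append)
      with d(1,4) have "d \<in> double_points ?cs"
        unfolding double_points_def by blast
      then show ?thesis ..
    next
      case 2
      then have "\<forall>(i, t)\<in>d. ?n \<le> i"
        unfolding d(1) by (simp add: case_prod_beta)
      with dV show ?thesis by blast
    qed
  qed
  note projective_link_diagramD(4)[OF K]
  moreover have "\<forall>p q. (p, q) \<in> crossings K \<longrightarrow> (q, p) \<notin> crossings K"
    using projective_link_diagramD(5)[OF K] by blast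
  moreover have "generic ?V" using os by (simp add: closing_arcs_def)
  moreover have "double_points ?cs \<union> ?W = double_points ?V"
    using sub cover by blast
  ultimately show ?thesis
    using ends disj
    unfolding virtual_link_diagram_def pi_diagram_def diagram.simps virtual_diagram.simps
    by (intro conjI ballI; simp)
qed

section \<open>States and brackets\<close>

text \<open>The part of the diagram that no smoothing touches: parameters away from the two preimages
  of every classical crossing. Virtual crossings are not removed and, parameters (rather than
  points of the plane) being used, a curve passes straight through them.\<close>

definition cuts :: "'a diagram_scheme \<Rightarrow> param set" where
  "cuts D = \<Union> (unordered ` crossings D)"

definition uncut :: "'a diagram_scheme \<Rightarrow> param set" where
  "uncut D = params (strands D) - cuts D"

definition same_segment :: "'a diagram_scheme \<Rightarrow> (param \<times> param) set" where
  "same_segment D = {((i, t), (j, u)). (i, t) \<in> uncut D \<and> (j, u) \<in> uncut D \<and> i = j \<and>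
     (\<forall>v\<in>open_segment t u. (i, v) \<notin> cuts D)}"

text \<open>\<open>half_branch D p d\<close> is the piece of strand next to \<open>p\<close>, after \<open>p\<close> for \<open>d = 1\<close> and before
  \<open>p\<close> for \<open>d = - 1\<close>. It leaves the crossing in the direction \<open>d *\<^sub>R tangent (strands D) p\<close>.\<close>

definition half_branch :: "'a diagram_scheme \<Rightarrow> param \<Rightarrow> real \<Rightarrow> param set" where
  "half_branch D p d = {(i, t). (i, t) \<in> uncut D \<and> i = fst p \<and> sgn (t - snd p) = d \<and>
     (\<forall>v\<in>open_segment (snd p) t. (i, v) \<notin> cuts D)}"

text \<open>Let \<open>u\<close> be the direction of a half of the overstrand and \<open>v\<close> that of a half of the
  understrand. The sector between them is swept when the overstrand is turned counterclockwise
  towards the understrand iff \<open>det2 u v > 0\<close>. The A-smoothing merges the two swept sectors, so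
  its two arcs run around the other two sectors and connect the halves with \<open>det2 u v < 0\<close>; the
  B-smoothing connects those with \<open>det2 u v > 0\<close>. A state is the set \<open>S\<close> of the crossings that
  receive an A-smoothing.\<close>

definition smoothing ::
  "'a diagram_scheme \<Rightarrow> (param \<times> param) set \<Rightarrow> (param \<times> param) set" where
  "smoothing D S = {(x, y). \<exists>(p, q)\<in>crossings D. \<exists>d\<in>{1, - 1}. \<exists>e\<in>{1, - 1}.
     x \<in> half_branch D p d \<and> y \<in> half_branch D q e \<and>
     (let w = det2 (d *\<^sub>R tangent (strands D) p) (e *\<^sub>R tangent (strands D) q)
      in if (p, q) \<in> S then w < 0 else w > 0)}"

text \<open>Gluing of the ends of the paths, where \<open>E\<close> is the identification of points in the ambient
  surface.\<close>

definition gluing ::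
  "(complex \<Rightarrow> complex \<Rightarrow> bool) \<Rightarrow> 'a diagram_scheme \<Rightarrow> (param \<times> param) set" where
  "gluing E D = {(p, q). p \<in> end_params (strands D) \<and> q \<in> end_params (strands D) \<and>
     E (pt (strands D) p) (pt (strands D) q)}"

text \<open>A loop of a state is identified with the set of its parameters in \<open>uncut D\<close>.\<close>

definition state_loops ::
  "(complex \<Rightarrow> complex \<Rightarrow> bool) \<Rightarrow> 'a diagram_scheme \<Rightarrow> (param \<times> param) set \<Rightarrow> param set set" where
  "state_loops E D S =
     (let R = same_segment D \<union> smoothing D S \<union> gluing E D
      in uncut D // (R \<union> R\<inverse>)\<^sup>*)"

definition state_sum ::
  "(complex \<Rightarrow> complex \<Rightarrow> bool) \<Rightarrow> 'a diagram_scheme \<Rightarrow> laurent" where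
  "state_sum E D = (\<Sum>S\<in>Pow (crossings D).
     varA ^ card S * varA_inv ^ card (crossings D - S) *
     (- (varA ^ 2) - varA_inv ^ 2) ^ card (state_loops E D S))"

definition rp2_eq :: "complex \<Rightarrow> complex \<Rightarrow> bool" where
  "rp2_eq z w \<longleftrightarrow> z = w \<or> norm z = 1 \<and> w = - z"

definition projective_bracket :: "diagram \<Rightarrow> laurent" where
  "projective_bracket K = state_sum rp2_eq K"

definition virtual_bracket :: "virtual_diagram \<Rightarrow> laurent" where
  "virtual_bracket V = state_sum (=) V"

end

theory Submission
  imports Defs
begin

text \<open>The bracket is a state sum over the same crossings on both sides, so it is enough to compare
  the numbers of loops state by state. Passing from \<open>K\<close> to \<open>\<pi>(K)\<close> replaces the identification of two
  antipodal end points by an exterior arc joining them. Collapsing each exterior arc to the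
  end point of \<open>K\<close> at its start is a retraction that maps loops to loops, and it is inverse
  to the inclusion on the level of loops; virtual crossings play no role, because curves run
  straight through them.\<close>

section \<open>Equivalence closures and counting classes\<close>

lemma equiv_rtrancl_Un_converse: "equiv UNIV ((R \<union> R\<inverse>)\<^sup>*)"
  by (intro equivI refl_rtrancl sym_rtrancl sym_Un_converse trans_rtrancl) auto

text \<open>An equivalence relation absorbs inverse and composite steps, so only generating pairs
  need checking. This is applied to the identity when passing from \<open>K\<close> to \<pi>(K), and
  to \<open>collapse\<close> on the way back.\<close>

lemma rtrancl_Un_converse_map:
  assumes "\<And>x y. (x, y) \<in> R \<Longrightarrow> (f x, f y) \<in> r" and r: "equiv UNIV r"
    and "(x, y) \<in> (R \<union> R\<inverse>)\<^sup>*"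
  shows "(f x, f y) \<in> r"
  using assms(3)
proof (induction rule: rtrancl_induct)
  case base
  show ?case using r by (simp add: equiv_def refl_on_def)
next
  case (step y z)
  then have "(f y, f z) \<in> r"
    using assms(1) r by (auto simp: equiv_def dest: symD)
  with step.IH show ?case using r by (meson equiv_def transD)
qed

text \<open>Saturating classes under \<open>r'\<close> is a bijection: \<open>f\<close> moves points
  only within their \<open>r'\<close>-class, which gives surjectivity, and turns
  \<open>r'\<close>-related points into \<open>r\<close>-related ones while fixing \<open>A\<close>,
  which gives injectivity.\<close>

lemma card_quotient_retract:
  assumes r: "equiv UNIV r" and r': "equiv UNIV r'" and sub: "r \<subseteq> r'" and AB: "A \<subseteq> B"
    and f: "\<And>x. x \<in> B \<Longrightarrow> f x \<in> A" "\<And>x. x \<in> A \<Longrightarrow> f x = x"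
      "\<And>x. x \<in> B \<Longrightarrow> (x, f x) \<in> r'" "\<And>x y. (x, y) \<in> r' \<Longrightarrow> (f x, f y) \<in> r"
  shows "card (A // r) = card (B // r')"
proof -
  have img: "r' `` (r `` {x}) = r' `` {x}" for x
  proof -
    have "(x, x) \<in> r" using r by (simp add: equiv_def refl_on_def)
    moreover have "trans r'" using r' by (simp add: equiv_def)
    ultimately show ?thesis using sub by (auto dest: transD)
  qed
  have "inj_on ((``) r') (A // r)"
  proof (rule inj_onI)
    fix X Y assume "X \<in> A // r" "Y \<in> A // r" and eq: "r' `` X = r' `` Y"
    then obtain x y where xy: "x \<in> A" "X = r `` {x}" "y \<in> A" "Y = r `` {y}"
      by (auto elim!: quotientE)
    with eq have "r' `` {x} = r' `` {y}" by (simp add: img)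
    then have "(x, y) \<in> r'" using eq_equiv_class[OF _ r'] by blast
    then have "(x, y) \<in> r" using f(2,4) xy by fastforce
    then show "X = Y" using equiv_class_eq[OF r] xy by blast
  qed
  moreover have "(``) r' ` (A // r) = B // r'"
  proof
    show "(``) r' ` (A // r) \<subseteq> B // r'"
      using AB by (auto simp: img elim!: quotientE intro!: quotientI)
    show "B // r' \<subseteq> (``) r' ` (A // r)"
    proof
      fix Y assume "Y \<in> B // r'"
      then obtain y where y: "y \<in> B" "Y = r' `` {y}" by (auto elim: quotientE)
      then have "Y = r' `` (r `` {f y})"
        using equiv_class_eq[OF r' f(3)] by (simp add: img)
      then show "Y \<in> (``) r' ` (A // r)" using f(1)[OF y(1)] by (auto intro: quotientI)
    qed
  qed
  ultimately show ?thesis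
    by (metis card_image)
qed

section \<open>Structure shared by \<open>K\<close> and \<pi>(K)\<close>

lemma rp2_eq_sym: "rp2_eq z w \<Longrightarrow> rp2_eq w z"
  by (auto simp: rp2_eq_def)

lemma rp2_eq_trans: "rp2_eq z w \<Longrightarrow> rp2_eq w v \<Longrightarrow> rp2_eq z v"
  by (auto simp: rp2_eq_def)

lemma strands_pi [simp]: "strands (pi_diagram K os) = strands K @ os"
  and crossings_pi [simp]: "crossings (pi_diagram K os) = crossings K"
  by (simp_all add: pi_diagram_def)

lemma cuts_pi [simp]: "cuts (pi_diagram K os) = cuts K"
  by (simp add: cuts_def)

text \<open>Crossings are double points of \<open>K\<close>, and these are formed from inner
  parameters of its paths; hence neither path ends nor exterior arcs are ever cut.\<close>

lemma cuts_inner: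
  assumes "projective_link_diagram K"
  shows "cuts K \<subseteq> inner_params (strands K)"
  using projective_link_diagramD(4)[OF assms] by (auto simp: cuts_def double_points_def)

lemma crossing_inner:
  assumes "projective_link_diagram K" "(p, q) \<in> crossings K"
  shows "p \<in> inner_params (strands K)" "q \<in> inner_params (strands K)"
proof -
  have "{p, q} \<subseteq> cuts K"
    using assms(2) by (force simp: cuts_def unordered_def)
  with cuts_inner[OF assms(1)]
  show "p \<in> inner_params (strands K)" "q \<in> inner_params (strands K)" by auto
qed

lemma uncut_pi_inner:
  "i < length (strands K) \<Longrightarrow> (i, t) \<in> uncut (pi_diagram K os) \<longleftrightarrow> (i, t) \<in> uncut K"
  by (auto simp: uncut_def params_def)

lemma uncut_less: "(i, t) \<in> uncut K \<Longrightarrow> i < length (strands K)"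
  by (auto simp: uncut_def params_def)

lemma uncut_pi_outer:
  assumes "projective_link_diagram K" "\<not> i < length (strands K)"
  shows "(i, t) \<in> uncut (pi_diagram K os) \<longleftrightarrow> i - length (strands K) < length os \<and> t \<in> {0..1}"
  using cuts_inner[OF assms(1)] assms(2) by (auto simp: uncut_def params_def inner_params_def)

lemma end_params_uncut:
  assumes "projective_link_diagram K" "p \<in> end_params (strands K)"
  shows "p \<in> uncut K"
  using cuts_inner[OF assms(1)] assms(2)
  by (auto simp: uncut_def params_def inner_params_def end_params_def)

text \<open>A half branch stays on the path of its base parameter, and exterior arcs add new paths
  but no cuts.\<close>

lemma half_branch_pi:
  assumes "fst p < length (strands K)"
  shows "half_branch (pi_diagram K os) p d = half_branch K p d"
  using assms by (auto simp: half_branch_def uncut_pi_inner)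

lemma tangent_append: "fst p < length cs \<Longrightarrow> tangent (cs @ os) p = tangent cs p"
  by (simp add: tangent_def nth_append)

text \<open>Both preimages of a crossing lie on paths of \<open>K\<close>, where half branches and
  tangents are the same in both diagrams.\<close>

lemma smoothing_pi:
  assumes "projective_link_diagram K"
  shows "smoothing (pi_diagram K os) S = smoothing K S"
proof -
  have "fst p < length (strands K) \<and> fst q < length (strands K)" if "(p, q) \<in> crossings K" for p q
    using crossing_inner[OF assms that] by (auto simp: inner_params_def)
  then have "(x, y) \<in> smoothing (pi_diagram K os) S \<longleftrightarrow> (x, y) \<in> smoothing K S" for x y
    unfolding smoothing_def crossings_pi strands_pi mem_Collect_eq prod.case
    by (intro bex_cong refl) (auto simp: half_branch_pi tangent_append)
  then show ?thesis by auto
qed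

lemma smoothing_uncut: "smoothing K S \<subseteq> uncut K \<times> uncut K"
  by (auto simp: smoothing_def half_branch_def)

lemma same_segment_pi_inner:
  assumes "fst x < length (strands K)"
  shows "(x, y) \<in> same_segment (pi_diagram K os) \<longleftrightarrow> (x, y) \<in> same_segment K"
  using assms by (cases x; cases y) (auto simp: same_segment_def uncut_pi_inner)

text \<open>Virtual crossings do not cut, so an exterior arc is a single segment, ends
  included.\<close>

lemma same_segment_pi_outer:
  assumes K: "projective_link_diagram K" and j: "j < length os"
    and "t \<in> {0..1}" "u \<in> {0..1}"
  shows "((length (strands K) + j, t), (length (strands K) + j, u)) \<in> same_segment (pi_diagram K os)"
proof -
  have "(length (strands K) + j, v) \<notin> cuts K" for v
    using cuts_inner[OF K] by (auto simp: inner_params_def)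
  then show ?thesis
    using assms by (auto simp: same_segment_def uncut_pi_outer)
qed

section \<open>Collapsing exterior arcs\<close>

text \<open>The image of an exterior parameter depends only on the index of its arc, so a whole arc
  goes to one parameter. For an admissible choice of arcs, \<open>SOME\<close> has a witness because
  each arc starts at a boundary point of \<open>K\<close>.\<close>

definition collapse :: "diagram \<Rightarrow> curve_system \<Rightarrow> param \<Rightarrow> param" where
  "collapse K os x = (if fst x < length (strands K) then x
     else SOME p. p \<in> end_params (strands K) \<and>
       pt (strands K) p = (os ! (fst x - length (strands K))) 0)"

lemma collapse_outer:
  assumes os: "closing_arcs K os" and "j < length os"
  shows "collapse K os (length (strands K) + j, t) \<in> end_params (strands K)"
    and "pt (strands K) (collapse K os (length (strands K) + j, t)) = (os ! j) 0"
proof -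
  have "(os ! j) 0 \<in> boundary_points (strands K)"
    using assms by (auto simp: closing_arcs_def)
  then have "\<exists>p. p \<in> end_params (strands K) \<and> pt (strands K) p = (os ! j) 0"
    unfolding boundary_points_def by (auto simp del: split_paired_Ex split_paired_All)
  from someI_ex[OF this]
  show "collapse K os (length (strands K) + j, t) \<in> end_params (strands K)"
    "pt (strands K) (collapse K os (length (strands K) + j, t)) = (os ! j) 0"
    by (simp_all add: collapse_def)
qed

lemma closing_arc_ends:
  assumes "closing_arcs K os" "j < length os"
  shows "norm ((os ! j) 0) = 1" "(os ! j) 1 = - (os ! j) 0"
  using assms norm_boundary[of "(os ! j) 0" "strands K"] by (auto simp: closing_arcs_def)

text \<open>The end of an exterior arc at time 1 is sent to a parameter over the antipodal start, so
  the point is preserved only up to \<open>rp2_eq\<close>; all other ends keep their point.\<close>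

lemma collapse_end:
  assumes os: "closing_arcs K os" and x: "x \<in> end_params (strands K @ os)"
  shows "collapse K os x \<in> end_params (strands K)"
    and "rp2_eq (pt (strands K @ os) x) (pt (strands K) (collapse K os x))"
proof -
  have "collapse K os x \<in> end_params (strands K) \<and>
      rp2_eq (pt (strands K @ os) x) (pt (strands K) (collapse K os x))"
  proof (cases "fst x < length (strands K)")
    case True
    with x show ?thesis by (simp add: collapse_def end_params_append pt_append rp2_eq_def)
  next
    case False
    define j where "j = fst x - length (strands K)"
    have j: "j < length os" and xj: "x = (length (strands K) + j, snd x)" and t: "snd x \<in> {0, 1}"
      using False x by (auto simp: j_def end_params_def)
    have "pt (strands K @ os) x = (os ! j) (snd x)"
      using False by (simp add: pt_append) (simp add: pt_def j_def)
    moreover have "collapse K os x \<in> end_params (strands K)"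
        "pt (strands K) (collapse K os x) = (os ! j) 0"
      using collapse_outer[OF os j, of "snd x"] xj by simp_all
    ultimately show ?thesis
      using t closing_arc_ends[OF os j] by (auto simp: rp2_eq_def)
  qed
  then show "collapse K os x \<in> end_params (strands K)"
    "rp2_eq (pt (strands K @ os) x) (pt (strands K) (collapse K os x))" by auto
qed

section \<open>Comparing the loops of a fixed state\<close>

lemma card_state_loops_pi:
  assumes K: "projective_link_diagram K" and os: "closing_arcs K os"
  shows "card (state_loops rp2_eq K S) = card (state_loops (=) (pi_diagram K os) S)"
proof -
  let ?n = "length (strands K)" and ?V = "pi_diagram K os" and ?f = "collapse K os"
  define R where "R = same_segment K \<union> smoothing K S \<union> gluing rp2_eq K"
  define R' where "R' = same_segment ?V \<union> smoothing ?V S \<union> gluing (=) ?V"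
  let ?r = "(R \<union> R\<inverse>)\<^sup>*" and ?r' = "(R' \<union> R'\<inverse>)\<^sup>*"
  note equivs = equiv_rtrancl_Un_converse[of R] equiv_rtrancl_Un_converse[of R']
  have trans': "(x, z) \<in> ?r'" if "(x, y) \<in> ?r'" "(y, z) \<in> ?r'" for x y z
    using that by (rule rtrancl_trans)
  have R': "(x, y) \<in> ?r'" if "(x, y) \<in> R'" for x y
    using that by auto
  have outer: "((?n + j, t), (?n + j, u)) \<in> ?r'"
    if "j < length os" "t \<in> {0..1}" "u \<in> {0..1}" for j t u
    using same_segment_pi_outer[OF K that] by (intro R') (simp add: R'_def)
  have glue: "(x, y) \<in> ?r'"
    if "x \<in> end_params (strands K @ os)" "y \<in> end_params (strands K @ os)"
      "pt (strands K @ os) x = pt (strands K @ os) y" for x y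
    using that by (intro R') (simp add: R'_def gluing_def)
  have end_K: "x \<in> end_params (strands K @ os) \<and> pt (strands K @ os) x = pt (strands K) x"
    if "x \<in> end_params (strands K)" for x
  proof -
    have "fst x < ?n" using that by (auto simp: end_params_def)
    with that show ?thesis by (simp add: end_params_append pt_append)
  qed
  have end_o: "(?n + j, t) \<in> end_params (strands K @ os) \<and>
      pt (strands K @ os) (?n + j, t) = (os ! j) t"
    if "j < length os" "t \<in> {0, 1}" for j t
    using that by (auto simp: end_params_def pt_def)
  \<comment> \<open>Segments and smoothings of \<open>K\<close> persist in \<pi>(K); only an
    antipodal gluing has to be replaced by a path over an exterior arc.\<close>
  have RR': "(x, y) \<in> ?r'" if xy: "(x, y) \<in> R" for x y
  proof -
    consider "(x, y) \<in> same_segment K" | "(x, y) \<in> smoothing K S" | "(x, y) \<in> gluing rp2_eq K"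
      using xy by (auto simp: R_def)
    then show ?thesis
    proof cases
      case 1
      then have "fst x < ?n" by (auto simp: same_segment_def dest: uncut_less)
      with 1 show ?thesis by (intro R') (simp add: R'_def same_segment_pi_inner)
    next
      case 2
      then show ?thesis by (intro R') (simp add: R'_def smoothing_pi[OF K])
    next
      case 3
      then have x: "x \<in> end_params (strands K)" and y: "y \<in> end_params (strands K)"
        and e: "rp2_eq (pt (strands K) x) (pt (strands K) y)" by (auto simp: gluing_def)
      show ?thesis
      proof (cases "pt (strands K) x = pt (strands K) y")
        \<comment> \<open>Coinciding ends, such as those at the base point of a circle, are still
          glued by \<open>(=)\<close>.\<close>
        case True
        with end_K[OF x] end_K[OF y] show ?thesis by (intro glue) auto
      next
        case False
        with e have n1: "norm (pt (strands K) x) = 1"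
          and neg: "pt (strands K) y = - pt (strands K) x" by (auto simp: rp2_eq_def)
        from n1 x have "pt (strands K) x \<in> boundary_points (strands K)"
          by (auto simp: boundary_points_def)
        then obtain j where j: "j < length os" "pt (strands K) x \<in> {(os ! j) 0, (os ! j) 1}"
          using os unfolding closing_arcs_def by blast
        then obtain t where t: "t \<in> {0, 1}" "pt (strands K) x = (os ! j) t" by blast
        \<comment> \<open>The two ends of an arc are antipodal, so whichever end lies at
          \<open>x\<close>, the opposite one lies at \<open>y\<close>.\<close>
        then have t': "1 - t \<in> {0, 1}" "pt (strands K) y = (os ! j) (1 - t)"
          using neg closing_arc_ends(2)[OF os j(1)] by auto
        \<comment> \<open>The route from \<open>x\<close> to \<open>y\<close>: glue onto the arc,
          run along it, glue back onto \<open>K\<close>.\<close>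
        have "(x, (?n + j, t)) \<in> ?r'"
          using end_K[OF x] end_o[OF j(1) t(1)] t(2) by (intro glue) auto
        moreover have "((?n + j, t), (?n + j, 1 - t)) \<in> ?r'"
          using t(1) by (intro outer j(1)) auto
        moreover have "((?n + j, 1 - t), y) \<in> ?r'"
          using end_K[OF y] end_o[OF j(1) t'(1)] t'(2) by (intro glue) auto
        ultimately show ?thesis using trans' by blast
      qed
    qed
  qed
  have R'R: "(?f x, ?f y) \<in> ?r" if xy: "(x, y) \<in> R'" for x y
  proof -
    consider "(x, y) \<in> same_segment ?V" | "(x, y) \<in> smoothing K S" | "(x, y) \<in> gluing (=) ?V"
      using xy by (auto simp: R'_def smoothing_pi[OF K])
    then show ?thesis
    proof cases
      case 1
      then have eq: "fst x = fst y" by (auto simp: same_segment_def)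
      show ?thesis
      proof (cases "fst x < ?n")
        case True
        with 1 have "(x, y) \<in> R" by (simp add: same_segment_pi_inner R_def)
        with True eq show ?thesis by (auto simp: collapse_def)
      next
        case False
        \<comment> \<open>The collapse ignores the time on an exterior arc, so reflexivity
          suffices.\<close>
        with eq have "?f x = ?f y" by (simp add: collapse_def)
        then show ?thesis by simp
      qed
    next
      case 2
      \<comment> \<open>Smoothings join only parameters of \<open>K\<close>, which the collapse
        fixes.\<close>
      with smoothing_uncut[of K S] have "fst x < ?n" "fst y < ?n"
        by (cases x; cases y; auto dest: uncut_less)+
      with 2 show ?thesis by (auto simp: collapse_def R_def)
    next
      case 3
      then have x: "x \<in> end_params (strands K @ os)" and y: "y \<in> end_params (strands K @ os)"
        and e: "pt (strands K @ os) x = pt (strands K @ os) y" by (auto simp: gluing_def)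
      \<comment> \<open>Both images are identified with the common point of \<open>x\<close> and
        \<open>y\<close>, hence with each other.\<close>
      have "rp2_eq (pt (strands K) (?f x)) (pt (strands K) (?f y))"
        using collapse_end(2)[OF os x] collapse_end(2)[OF os y] e
        by (metis rp2_eq_sym rp2_eq_trans)
      with collapse_end(1)[OF os x] collapse_end(1)[OF os y] have "(?f x, ?f y) \<in> R"
        by (simp add: R_def gluing_def)
      then show ?thesis by auto
    qed
  qed
  have outer_cases: "\<exists>j t. x = (?n + j, t) \<and> j < length os \<and> t \<in> {0..1}"
    if "x \<in> uncut ?V" "\<not> fst x < ?n" for x
  proof (intro exI)
    show "x = (?n + (fst x - ?n), snd x) \<and> fst x - ?n < length os \<and> snd x \<in> {0..1}"
      using that uncut_pi_outer[OF K, of "fst x" "snd x" os] by simp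
  qed
  have "card (uncut K // ?r) = card (uncut ?V // ?r')"
  proof (rule card_quotient_retract[where f = ?f, OF equivs])
    show "?r \<subseteq> ?r'"
      using rtrancl_Un_converse_map[of R "\<lambda>x. x", OF RR' equivs(2)] by auto
    show "uncut K \<subseteq> uncut ?V"
      by (auto simp: uncut_def params_def)
    show "?f x = x" if "x \<in> uncut K" for x
      using that by (cases x) (auto simp: collapse_def dest: uncut_less)
    show "(?f x, ?f y) \<in> ?r" if "(x, y) \<in> ?r'" for x y
      using rtrancl_Un_converse_map[of R' ?f, OF R'R equivs(1) that] .
    show "?f x \<in> uncut K" if x: "x \<in> uncut ?V" for x
    proof (cases "fst x < ?n")
      case True
      with x show ?thesis by (cases x) (simp add: collapse_def uncut_pi_inner)
    next
      case False
      from outer_cases[OF x this] collapse_outer(1)[OF os] show ?thesis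
        by (auto intro: end_params_uncut[OF K])
    qed
    show "(x, ?f x) \<in> ?r'" if x: "x \<in> uncut ?V" for x
    proof (cases "fst x < ?n")
      case True
      then show ?thesis by (simp add: collapse_def)
    next
      case False
      from outer_cases[OF x this] obtain j t
        where j: "j < length os" and t: "t \<in> {0..1}" and xj: "x = (?n + j, t)" by blast
      \<comment> \<open>Time 0 is the end over which \<open>collapse\<close> picks its parameter, so
        the next link is a gluing of equal points.\<close>
      have "(x, (?n + j, 0)) \<in> ?r'"
        unfolding xj using t by (intro outer j) auto
      moreover have "((?n + j, 0), ?f x) \<in> ?r'"
        using end_K[OF collapse_outer(1)[OF os j]] collapse_outer(2)[OF os j] end_o[OF j, of 0]
        by (intro glue) (auto simp: xj)
      ultimately show ?thesis by (rule trans')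
    qed
  qed
  then show ?thesis
    by (simp add: state_loops_def Let_def R_def R'_def)
qed

theorem mainTheorem3:
  fixes K :: diagram and os :: curve_system
  assumes "projective_link_diagram K"
    and "closing_arcs K os"
  shows "projective_bracket K = virtual_bracket (pi_diagram K os)"
  using card_state_loops_pi[OF assms]
  by (simp add: projective_bracket_def virtual_bracket_def state_sum_def)

end
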